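(* Let $T\mathcal{N}$ be endowed with the Kähler structure $(g,J,\omega)$ obtained by Dombrowski's construction from the Fisher metric and the exponential connection of the manifold $\mathcal{N}$ of Gaussian densities on $\mathbb{R}$. Then: (i) $\mathrm{Ric}(X,X)\le 0$ for all $X\in T(T\mathcal{N})$, where $\mathrm{Ric}$ is the Ricci tensor of $g$; (ii) $(T\mathcal{N},g)$ is not Einstein; in particular, the holomorphic sectional curvature of $T\mathcal{N}$ is not constant; (iii) the scalar curvature of $(T\mathcal{N},g)$ is constant and equal to $-6$.
   Context: $\mathcal{N}$ is the manifold of Gaussian densities $p(x;\mu,\sigma)=\frac{1}{\sqrt{2\pi}\sigma}e^{-(x-\mu)^2/(2\sigma^2)}$ on $\mathbb{R}$, with global natural coordinates $\theta_1=\mu/\sigma^2\in\mathbb{R}$, $\theta_2=-1/(2\sigma^2)<0$. With $\dot\theta_i=d\theta_i$ viewed as functions on $T\mathcal{N}$, $(\theta_1,\theta_2,\dot\theta_1,\dot\theta_2)$ are global coordinates on $T\mathcal{N}$ in which the Kähler structure is (with $I$ the $2\times 2$ identity matrix) $$g=\begin{bmatrix} h_F(\theta) & 0 \\ 0 & h_F(\theta) \end{bmatrix},\quad J=\begin{bmatrix} 0 & -I \\ I & 0 \end{bmatrix},\quad h_F(\theta)=\frac{1}{2\theta_2^2}\begin{bmatrix} -\theta_2 & \theta_1 \\ \theta_1 & \frac{\theta_2-\theta_1^2}{\theta_2} \end{bmatrix},\quad \omega=g(J\cdot,\cdot).$$ Conventions: $R(X,Y)Z=\nabla_X\nabla_YZ-\nabla_Y\nabla_XZ-\nabla_{[X,Y]}Z$,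 $\mathrm{Ric}(X,Y)=\mathrm{Trace}\{Z\mapsto R(Z,X)Y\}$, and the scalar curvature is the trace of the Ricci tensor with respect to $g$. A Riemannian manifold is Einstein if its Ricci tensor is a scalar multiple of the metric at each point. The holomorphic sectional curvature is $u\mapsto g(R(u,Ju)Ju,u)/g(u,u)^2$ for nonzero tangent vectors $u$. *)

theory Defs
  imports "HOL-Probability.Probability"
begin

section \<open>Riemannian geometry on open subsets of a Euclidean space\<close>

text \<open>
  A manifold covered by one global chart is identified with the open range of that chart. Tangent
  vectors are then elements of the model space, vector fields are functions on it, and a metric
  tensor is a map \<open>g\<close> such that \<open>g p u v\<close> is the inner product of \<open>u\<close> and \<open>v\<close> at \<open>p\<close>.
  An affine connection is given by its Christoffel map:
  \<open>(\<nabla>\<^sub>X Y)(p) = DY\<^sub>p(X(p)) + \<Gamma> p (X(p)) (Y(p))\<close>.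
  Values at points outside the chart range are irrelevant.
\<close>

type_synonym 'a metric = "'a \<Rightarrow> 'a \<Rightarrow> 'a \<Rightarrow> real"
type_synonym 'a connection = "'a \<Rightarrow> 'a \<Rightarrow> 'a \<Rightarrow> 'a"
type_synonym 'a endo_field = "'a \<Rightarrow> 'a \<Rightarrow> 'a"
type_synonym 'a vfield = "'a \<Rightarrow> 'a"

definition ddir :: "('a::real_normed_vector \<Rightarrow> 'b::real_normed_vector) \<Rightarrow> 'a \<Rightarrow> 'a \<Rightarrow> 'b" where
  "ddir f p u = frechet_derivative f (at p) u"

text \<open>The vector representing the covector \<open>\<alpha>\<close> at \<open>p\<close> with respect to the metric.\<close>

definition sharp :: "'a metric \<Rightarrow> 'a \<Rightarrow> ('a \<Rightarrow> real) \<Rightarrow> 'a" where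
  "sharp g p \<alpha> = (THE w. \<forall>z. g p w z = \<alpha> z)"

text \<open>
  The Christoffel map of the Levi-Civita connection: Koszul's formula for constant
  (hence pairwise commuting) vector fields.
\<close>

definition levi_civita :: "'a::euclidean_space metric \<Rightarrow> 'a connection" where
  "levi_civita g p u v = sharp g p (\<lambda>z.
     (ddir (\<lambda>q. g q v z) p u + ddir (\<lambda>q. g q u z) p v - ddir (\<lambda>q. g q u v) p z) / 2)"

definition covariant_deriv ::
    "'a::euclidean_space connection \<Rightarrow> 'a vfield \<Rightarrow> 'a vfield \<Rightarrow> 'a vfield" where
  "covariant_deriv \<Gamma> X Y p = ddir Y p (X p) + \<Gamma> p (X p) (Y p)"

definition lie_bracket :: "'a::euclidean_space vfield \<Rightarrow> 'a vfield \<Rightarrow> 'a vfield" where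
  "lie_bracket X Y p = ddir Y p (X p) - ddir X p (Y p)"

definition curvature_field ::
    "'a::euclidean_space connection \<Rightarrow> 'a vfield \<Rightarrow> 'a vfield \<Rightarrow> 'a vfield \<Rightarrow> 'a vfield" where
  "curvature_field \<Gamma> X Y Z p =
     covariant_deriv \<Gamma> X (covariant_deriv \<Gamma> Y Z) p
     - covariant_deriv \<Gamma> Y (covariant_deriv \<Gamma> X Z) p
     - covariant_deriv \<Gamma> (lie_bracket X Y) Z p"

text \<open>
  \<open>R(x,y)z\<close> for tangent vectors at \<open>p\<close>; since \<open>R\<close> is a tensor, they may be extended to
  vector fields arbitrarily, here as constant fields.
\<close>

definition curvature :: "'a::euclidean_space metric \<Rightarrow> 'a \<Rightarrow> 'a \<Rightarrow> 'a \<Rightarrow> 'a \<Rightarrow> 'a" where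
  "curvature g p x y z = curvature_field (levi_civita g) (\<lambda>_. x) (\<lambda>_. y) (\<lambda>_. z) p"

definition trace_endo :: "('a::euclidean_space \<Rightarrow> 'a) \<Rightarrow> real" where
  "trace_endo L = (\<Sum>b\<in>Basis. L b \<bullet> b)"

definition ricci :: "'a::euclidean_space metric \<Rightarrow> 'a \<Rightarrow> 'a \<Rightarrow> 'a \<Rightarrow> real" where
  "ricci g p x y = trace_endo (\<lambda>z. curvature g p z x y)"

definition scalar_curvature :: "'a::euclidean_space metric \<Rightarrow> 'a \<Rightarrow> real" where
  "scalar_curvature g p = trace_endo (\<lambda>x. sharp g p (ricci g p x))"

definition einstein :: "'a::euclidean_space set \<Rightarrow> 'a metric \<Rightarrow> bool" where
  "einstein U g \<longleftrightarrow> (\<forall>p\<in>U. \<exists>c. \<forall>x y. ricci g p x y = c * g p x y)"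

definition holomorphic_sectional_curvature ::
    "'a::euclidean_space metric \<Rightarrow> 'a endo_field \<Rightarrow> 'a \<Rightarrow> 'a \<Rightarrow> real" where
  "holomorphic_sectional_curvature g J p u =
     g p (curvature g p u (J p u) (J p u)) u / (g p u u)\<^sup>2"


section \<open>Dombrowski's construction\<close>

text \<open>
  The tangent bundle of a chart domain in \<open>'a\<close> has coordinates \<open>(q, w)\<close> in \<open>'a \<times> 'a\<close>, where \<open>w\<close> is
  the coordinate vector of the tangent vector at \<open>q\<close>. A vector \<open>(a, b)\<close> tangent to the bundle
  at \<open>(q, w)\<close> has horizontal part \<open>a\<close> (its image under the differential of the projection) and
  vertical part \<open>K (a, b)\<close>, with \<open>K\<close> the connector of the connection. This identifies the
  tangent space at \<open>(q, w)\<close> with two copies of the tangent space at \<open>q\<close>; there \<open>g\<close> is the orthogonal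
  sum of two copies of \<open>h\<close>, \<open>J (x, y) = (- y, x)\<close>, and \<open>\<omega> = g (J _) _\<close>.
\<close>

definition connector :: "'a::euclidean_space connection \<Rightarrow> 'a \<times> 'a \<Rightarrow> 'a \<times> 'a \<Rightarrow> 'a" where
  "connector \<Gamma> P A = snd A + \<Gamma> (fst P) (fst A) (snd P)"

definition split_vector ::
    "'a::euclidean_space connection \<Rightarrow> 'a \<times> 'a \<Rightarrow> 'a \<times> 'a \<Rightarrow> 'a \<times> 'a" where
  "split_vector \<Gamma> P A = (fst A, connector \<Gamma> P A)"

definition join_vector ::
    "'a::euclidean_space connection \<Rightarrow> 'a \<times> 'a \<Rightarrow> 'a \<times> 'a \<Rightarrow> 'a \<times> 'a" where
  "join_vector \<Gamma> P S = (fst S, snd S - \<Gamma> (fst P) (fst S) (snd P))"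

lemma join_split_vector:
  "join_vector \<Gamma> P (split_vector \<Gamma> P A) = A" "split_vector \<Gamma> P (join_vector \<Gamma> P S) = S"
  by (simp_all add: join_vector_def split_vector_def connector_def)

definition dombrowski_g ::
    "'a::euclidean_space metric \<Rightarrow> 'a connection \<Rightarrow> ('a \<times> 'a) metric" where
  "dombrowski_g h \<Gamma> P A B =
     h (fst P) (fst A) (fst B) + h (fst P) (connector \<Gamma> P A) (connector \<Gamma> P B)"

definition dombrowski_J :: "'a::euclidean_space connection \<Rightarrow> ('a \<times> 'a) endo_field" where
  "dombrowski_J \<Gamma> P A = join_vector \<Gamma> P (case split_vector \<Gamma> P A of (x, y) \<Rightarrow> (- y, x))"

definition dombrowski_omega ::
    "'a::euclidean_space metric \<Rightarrow> 'a connection \<Rightarrow> ('a \<times> 'a) metric" where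
  "dombrowski_omega h \<Gamma> P A B = dombrowski_g h \<Gamma> P (dombrowski_J \<Gamma> P A) B"

definition dombrowski ::
    "'a::euclidean_space metric \<Rightarrow> 'a connection \<Rightarrow>
     ('a \<times> 'a) metric \<times> ('a \<times> 'a) endo_field \<times> ('a \<times> 'a) metric" where
  "dombrowski h \<Gamma> = (dombrowski_g h \<Gamma>, dombrowski_J \<Gamma>, dombrowski_omega h \<Gamma>)"


section \<open>Statistical manifolds\<close>

text \<open>
  \<open>p \<theta> x\<close> is the value at \<open>x\<close> of the probability density with parameter \<open>\<theta>\<close>. The exponential
  connection \<open>\<nabla>\<close> is determined by
  \<open>h(\<nabla>\<^bsub>\<partial>\<^sub>i\<^esub> \<partial>\<^sub>j, \<partial>\<^sub>k) = E[(\<partial>\<^sub>i \<partial>\<^sub>j ln p) (\<partial>\<^sub>k ln p)]\<close>.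
\<close>

definition score :: "('a::euclidean_space \<Rightarrow> real \<Rightarrow> real) \<Rightarrow> 'a \<Rightarrow> 'a \<Rightarrow> real \<Rightarrow> real" where
  "score p \<theta> u x = ddir (\<lambda>t. ln (p t x)) \<theta> u"

definition expectation_at :: "('a \<Rightarrow> real \<Rightarrow> real) \<Rightarrow> 'a \<Rightarrow> (real \<Rightarrow> real) \<Rightarrow> real" where
  "expectation_at p \<theta> f = (LINT x|lborel. p \<theta> x * f x)"

definition fisher_metric :: "('a::euclidean_space \<Rightarrow> real \<Rightarrow> real) \<Rightarrow> 'a metric" where
  "fisher_metric p \<theta> u v = expectation_at p \<theta> (\<lambda>x. score p \<theta> u x * score p \<theta> v x)"

definition exponential_connection ::
    "('a::euclidean_space \<Rightarrow> real \<Rightarrow> real) \<Rightarrow> 'a connection" where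
  "exponential_connection p \<theta> u v = sharp (fisher_metric p) \<theta> (\<lambda>w.
     expectation_at p \<theta> (\<lambda>x. ddir (\<lambda>t. score p t v x) \<theta> u * score p \<theta> w x))"


section \<open>Gaussian densities in natural coordinates\<close>

definition gaussian_domain :: "(real^2) set" where
  "gaussian_domain = {\<theta>. \<theta> $ 2 < 0}"

definition gaussian :: "real^2 \<Rightarrow> real \<Rightarrow> real" where
  "gaussian \<theta> = normal_density (- \<theta> $ 1 / (2 * \<theta> $ 2)) (sqrt (- 1 / (2 * \<theta> $ 2)))"

text \<open>Coordinate domain of the tangent bundle of the manifold of Gaussian densities.\<close>

definition gaussian_TN :: "((real^2) \<times> (real^2)) set" where
  "gaussian_TN = gaussian_domain \<times> UNIV"

lemma gaussian_natural_coordinates: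
  assumes "\<sigma> > 0"
  shows "vector [\<mu> / \<sigma>\<^sup>2, - 1 / (2 * \<sigma>\<^sup>2)] \<in> gaussian_domain"
    and "gaussian (vector [\<mu> / \<sigma>\<^sup>2, - 1 / (2 * \<sigma>\<^sup>2)]) = normal_density \<mu> \<sigma>"
  using assms by (simp_all add: gaussian_domain_def gaussian_def)


section \<open>Coordinate expression of the structure\<close>

text \<open>
  In natural coordinates the Christoffel map of the exponential connection vanishes, and \<open>g\<close>
  and \<open>J\<close> are given by the matrices \<open>diag(h, h)\<close> and \<open>[[0, -I], [I, 0]]\<close>, with \<open>h\<close> the
  matrix \<open>fisher_matrix\<close>.
\<close>


definition fisher_matrix :: "real^2 \<Rightarrow> real^2^2" where
  "fisher_matrix \<theta> = (1 / (2 * (\<theta>$2)\<^sup>2)) *\<^sub>R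
     vector [vector [- \<theta>$2, \<theta>$1], vector [\<theta>$1, (\<theta>$2 - (\<theta>$1)\<^sup>2) / \<theta>$2]]"

lemma ln_gaussian:
  assumes "\<theta>$2 < 0"
  shows "ln (gaussian \<theta> x) =
    \<theta>$1 * x + \<theta>$2 * x\<^sup>2 + (\<theta>$1)\<^sup>2 / (4 * \<theta>$2) + ln (- \<theta>$2) / 2 - ln pi / 2"
proof -
  let ?v = "- 1 / (2 * \<theta>$2)"
  have v: "?v > 0" using assms by (simp add: divide_neg_neg)
  have s: "(sqrt ?v)\<^sup>2 = ?v" using v by (meson less_imp_le real_sqrt_pow2)
  have "ln (gaussian \<theta> x) = ln (1 / sqrt (2 * pi * ?v)) + - (x - (- \<theta>$1 / (2 * \<theta>$2)))\<^sup>2 / (2 * ?v)"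
    unfolding gaussian_def normal_density_def s using v by (subst ln_mult) auto
  also have "2 * pi * ?v = pi / (- \<theta>$2)"
    using assms by (simp add: field_simps)
  also have "ln (1 / sqrt (pi / (- \<theta>$2))) = ln (- \<theta>$2) / 2 - ln pi / 2"
    using assms by (simp add: ln_div ln_sqrt field_simps del: divide_minus_right)
  also have "- (x - (- \<theta>$1 / (2 * \<theta>$2)))\<^sup>2 / (2 * ?v) = \<theta>$1 * x + \<theta>$2 * x\<^sup>2 + (\<theta>$1)\<^sup>2 / (4 * \<theta>$2)"
    using assms by (simp add: field_simps power2_eq_square)
  finally show ?thesis by simp
qed

lemma open_gaussian_domain: "open gaussian_domain"
  unfolding gaussian_domain_def by (intro open_Collect_less continuous_intros)

lemma ddir_eqI:
  assumes "(f has_derivative f') (at p)"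
  shows "ddir f p u = f' u"
  using frechet_derivative_at[OF assms] by (simp add: ddir_def)

lemma has_derivative_nth: "(\<lambda>u. u $ i) = f' \<Longrightarrow> ((\<lambda>t::real^'n. t $ i) has_derivative f') (at p)"
  using bounded_linear_imp_has_derivative[OF bounded_linear_vec_nth[of i]] by auto

lemma ddir_transform:
  assumes "open S" "p \<in> S" "\<And>q. q \<in> S \<Longrightarrow> f q = f' q" "(f' has_derivative D) (at p)"
  shows "ddir f p u = D u"
  by (rule ddir_eqI, rule has_derivative_transform_within_open[OF assms(4,1,2)]) (simp add: assms(3))

lemma score_gaussian:
  assumes "\<theta> \<in> gaussian_domain"
  shows "score gaussian \<theta> u x =
    u$1 * (x + \<theta>$1 / (2 * \<theta>$2)) + u$2 * (x\<^sup>2 - (\<theta>$1)\<^sup>2 / (4 * (\<theta>$2)\<^sup>2) + 1 / (2 * \<theta>$2))"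
proof -
  have t: "\<theta>$2 < 0" using assms by (simp add: gaussian_domain_def)
  have "score gaussian \<theta> u x = u$1 * x + u$2 * x\<^sup>2
      + (2 * \<theta>$1 * u$1 / (4 * \<theta>$2) - (\<theta>$1)\<^sup>2 * (4 * u$2) / (4 * \<theta>$2)\<^sup>2) + u$2 / \<theta>$2 / 2"
    unfolding score_def
    apply (rule ddir_transform[OF open_gaussian_domain assms])
     apply (rule ln_gaussian, simp add: gaussian_domain_def)
    using t by (auto intro!: derivative_eq_intros has_derivative_nth simp: fun_eq_iff field_simps power2_eq_square)
  also have "\<dots> = u$1 * (x + \<theta>$1 / (2 * \<theta>$2)) + u$2 * (x\<^sup>2 - (\<theta>$1)\<^sup>2 / (4 * (\<theta>$2)\<^sup>2) + 1 / (2 * \<theta>$2))"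
    using t by (simp add: field_simps power2_eq_square)
  finally show ?thesis .
qed

lemma ddir_score_gaussian:
  assumes "\<theta> \<in> gaussian_domain"
  shows "\<exists>c. \<forall>x. ddir (\<lambda>t. score gaussian t v x) \<theta> u = c"
proof -
  have t: "\<theta>$2 < 0" using assms by (simp add: gaussian_domain_def)
  have "ddir (\<lambda>t. score gaussian t v x) \<theta> u =
    v$1 * (u$1 / (2 * \<theta>$2) - \<theta>$1 * u$2 / (2 * (\<theta>$2)\<^sup>2))
    + v$2 * (- \<theta>$1 * u$1 / (2 * (\<theta>$2)\<^sup>2) + (\<theta>$1)\<^sup>2 * u$2 / (2 * (\<theta>$2)^3) - u$2 / (2 * (\<theta>$2)\<^sup>2))" for x
    apply (rule ddir_transform[OF open_gaussian_domain assms])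
     apply (rule score_gaussian, assumption)
    using t by (auto intro!: derivative_eq_intros has_derivative_nth simp: fun_eq_iff field_simps power2_eq_square power3_eq_cube)
  then show ?thesis by blast
qed

lemma expectation_poly:
  assumes "\<theta> \<in> gaussian_domain"
  defines "m \<equiv> - \<theta>$1 / (2 * \<theta>$2)" and "s \<equiv> - 1 / (2 * \<theta>$2)"
  shows "expectation_at gaussian \<theta> (\<lambda>x. a + b * (x - m) + c * (x - m)\<^sup>2 + d * (x - m)^3 + e * (x - m)^4)
       = a + c * s + e * (3 * s\<^sup>2)"
proof -
  have t: "\<theta>$2 < 0" using assms by (simp add: gaussian_domain_def)
  have s0: "s > 0" using t by (simp add: s_def divide_neg_neg)
  have p: "sqrt s > 0" using s0 by simp
  have g: "gaussian \<theta> = normal_density m (sqrt s)" by (simp add: gaussian_def m_def s_def)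
  let ?n = "normal_density m (sqrt s)"
  have 0: "has_bochner_integral lborel (\<lambda>x. ?n x * (x - m)^0) 1"
    using normal_moment_even[OF p, of m 0] by simp
  have 1: "has_bochner_integral lborel (\<lambda>x. ?n x * (x - m)^1) 0"
    using normal_moment_odd[OF p, of m 0] by simp
  have 2: "has_bochner_integral lborel (\<lambda>x. ?n x * (x - m)^2) s"
    using normal_moment_even[OF p, of m 1] s0 by (simp add: fact_numeral)
  have 3: "has_bochner_integral lborel (\<lambda>x. ?n x * (x - m)^3) 0"
    using normal_moment_odd[OF p, of m 1] by (simp add: numeral_3_eq_3 numeral_2_eq_2)
  have 4: "has_bochner_integral lborel (\<lambda>x. ?n x * (x - m)^4) (3 * s\<^sup>2)"
    using normal_moment_even[OF p, of m 2] s0 by (simp add: fact_numeral field_simps)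
  have "has_bochner_integral lborel (\<lambda>x. a * (?n x * (x - m)^0) + b * (?n x * (x - m)^1)
      + c * (?n x * (x - m)^2) + d * (?n x * (x - m)^3) + e * (?n x * (x - m)^4))
      (a * 1 + b * 0 + c * s + d * 0 + e * (3 * s\<^sup>2))"
    by (intro has_bochner_integral_add has_bochner_integral_mult_right 0 1 2 3 4)
  from has_bochner_integral_integral_eq[OF this]
  show ?thesis unfolding expectation_at_def g by (simp add: algebra_simps)
qed

lemma score_centred:
  assumes "\<theta> \<in> gaussian_domain"
  defines "m \<equiv> - \<theta>$1 / (2 * \<theta>$2)" and "s \<equiv> - 1 / (2 * \<theta>$2)"
  shows "score gaussian \<theta> u x = - u$2 * s + (u$1 + 2 * m * u$2) * (x - m) + u$2 * (x - m)\<^sup>2"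
proof -
  have t: "\<theta>$2 < 0" using assms by (simp add: gaussian_domain_def)
  show ?thesis unfolding score_gaussian[OF assms(1)] m_def s_def using t
    by (simp add: field_simps power2_eq_square)
qed

lemma fisher_metric_gaussian:
  assumes "\<theta> \<in> gaussian_domain"
  shows "fisher_metric gaussian \<theta> u v = u \<bullet> (fisher_matrix \<theta> *v v)"
proof -
  have t: "\<theta>$2 < 0" using assms by (simp add: gaussian_domain_def)
  define m where "m = - \<theta>$1 / (2 * \<theta>$2)"
  define s where "s = - 1 / (2 * \<theta>$2)"
  define U V where "U = u$1 + 2 * m * u$2" and "V = v$1 + 2 * m * v$2"
  have "fisher_metric gaussian \<theta> u v = expectation_at gaussian \<theta>
    (\<lambda>x. (u$2 * v$2 * s\<^sup>2) + (- (u$2 * s * V) - (v$2 * s * U)) * (x - m)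
      + (U * V - 2 * u$2 * v$2 * s) * (x - m)\<^sup>2 + (U * v$2 + V * u$2) * (x - m)^3
      + (u$2 * v$2) * (x - m)^4)"
    unfolding fisher_metric_def score_centred[OF assms] m_def[symmetric] s_def[symmetric]
      U_def[symmetric] V_def[symmetric]
    by (rule arg_cong[where f="expectation_at gaussian \<theta>"])
       (simp add: fun_eq_iff algebra_simps power2_eq_square power3_eq_cube power4_eq_xxxx)
  also have "\<dots> = U * V * s + 2 * u$2 * v$2 * s\<^sup>2"
    unfolding expectation_poly[OF assms, folded m_def s_def]
    by (simp add: algebra_simps power2_eq_square)
  also have "\<dots> = u \<bullet> (fisher_matrix \<theta> *v v)"
    unfolding U_def V_def m_def s_def fisher_matrix_def using t
    by (simp add: inner_vec_def sum_2 matrix_vector_mult_def field_simps power2_eq_square)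
  finally show ?thesis .
qed

lemma exponential_connection_gaussian:
  assumes "\<theta> \<in> gaussian_domain"
  shows "exponential_connection gaussian \<theta> u v = 0"
proof -
  have t: "\<theta>$2 < 0" using assms by (simp add: gaussian_domain_def)
  obtain c where c: "\<And>x. ddir (\<lambda>t. score gaussian t v x) \<theta> u = c"
    using ddir_score_gaussian[OF assms] by metis
  have z: "expectation_at gaussian \<theta> (\<lambda>x. c * score gaussian \<theta> w x) = 0" for w
  proof -
    define m where "m = - \<theta>$1 / (2 * \<theta>$2)"
    define s where "s = - 1 / (2 * \<theta>$2)"
    show ?thesis
      using expectation_poly[OF assms, folded m_def s_def, of "- c * w$2 * s" "c * (w$1 + 2 * m * w$2)" "c * w$2" 0 0]
      unfolding score_centred[OF assms, folded m_def s_def]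
      by (simp add: algebra_simps)
  qed
  have "(THE w. \<forall>y. w \<bullet> (fisher_matrix \<theta> *v y) = 0) = 0"
  proof (rule the_equality)
    fix w assume w: "\<forall>y. w \<bullet> (fisher_matrix \<theta> *v y) = 0"
    have e: "w \<bullet> (fisher_matrix \<theta> *v vector [a, b]) * (2 * (\<theta>$2)\<^sup>2) = w$1 * (- \<theta>$2 * a + \<theta>$1 * b)
       + w$2 * (\<theta>$1 * a + (\<theta>$2 - (\<theta>$1)\<^sup>2) / \<theta>$2 * b)" for a b
      unfolding fisher_matrix_def using t
      by (simp add: inner_vec_def sum_2 matrix_vector_mult_def field_simps power2_eq_square)
    have "w$2 * \<theta>$2 = 0"
      using e[of "\<theta>$1" "\<theta>$2"] w t by (simp add: field_simps power2_eq_square)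
    then have w2: "w$2 = 0" using t by simp
    then have "w$1 = 0" using e[of 1 0] w t by simp
    then show "w = 0" using w2 by (simp add: vec_eq_iff forall_2)
  qed simp
  then show ?thesis
    unfolding exponential_connection_def sharp_def c z fisher_metric_gaussian[OF assms] .
qed

lemma dombrowski_gaussian:
  assumes "(g, J, \<omega>) = dombrowski (fisher_metric gaussian) (exponential_connection gaussian)"
    and "(\<theta>, \<theta>') \<in> gaussian_TN"
  shows "g (\<theta>, \<theta>') (a, b) (c, d) = a \<bullet> (fisher_matrix \<theta> *v c) + b \<bullet> (fisher_matrix \<theta> *v d)"
    and "J (\<theta>, \<theta>') (a, b) = (- b, a)"
  using assms
  by (simp_all add: dombrowski_def dombrowski_g_def dombrowski_J_def connector_def split_vector_def
      join_vector_def gaussian_TN_def fisher_metric_gaussian exponential_connection_gaussian)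

end

theory Submission
  imports Defs
begin

text \<open>
  In the coframe \<open>d\<theta>\<^sub>1 - (\<theta>\<^sub>1/\<theta>\<^sub>2) d\<theta>\<^sub>2\<close>, \<open>d\<theta>\<^sub>2\<close> the Fisher metric is diagonal, and
  the metric, its Levi-Civita connection and their derivatives are polynomial in \<open>\<theta>\<^sub>1/\<theta>\<^sub>2\<close> and
  \<open>1/\<theta>\<^sub>2\<close>. Since the Fisher metric is a Hessian metric, the Levi-Civita connection of the
  tangent bundle is the complex bilinear extension of that of the base. The Ricci tensor
  comes out as \<open>-3/(2 \<theta>\<^sub>2\<^sup>2)\<close> times the sum of the squares of \<open>d\<theta>\<^sub>2\<close> and \<open>d\<theta>\<^sub>2'\<close>: it is
  negative semidefinite of rank two, hence not a multiple of the metric, and its trace is \<open>-6\<close>.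
\<close>

section \<open>The Fisher metric in an adapted coframe\<close>

definition coframe1 :: "real^2 \<Rightarrow> real^2 \<Rightarrow> real" where
  "coframe1 \<theta> u = u$1 - \<theta>$1 / \<theta>$2 * u$2"

text \<open>The mean is \<open>- \<theta>$1 / (2 * \<theta>$2)\<close>, so
  \<open>coframe1 \<theta> u\<close> is the coefficient of the centred linear term of the score in
  direction \<open>u\<close>. The two summands are the contributions of the linear and of the
  quadratic part of the score to the Fisher metric.\<close>

definition fisher_form :: "real^2 \<Rightarrow> real^2 \<Rightarrow> real^2 \<Rightarrow> real" where
  "fisher_form \<theta> u v =
     - inverse (\<theta>$2) / 2 * (coframe1 \<theta> u * coframe1 \<theta> v) + (inverse (\<theta>$2))\<^sup>2 / 2 * (u$2 * v$2)"

text \<open>The third derivative of the log-partition function, whose Hessian is the metric; hence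
  its symmetry in all three arguments.\<close>

definition fisher_form_deriv :: "real^2 \<Rightarrow> real^2 \<Rightarrow> real^2 \<Rightarrow> real^2 \<Rightarrow> real" where
  "fisher_form_deriv \<theta> x u v =
     (inverse (\<theta>$2))\<^sup>2 / 2 * (x$2 * coframe1 \<theta> u * coframe1 \<theta> v
       + coframe1 \<theta> x * u$2 * coframe1 \<theta> v + coframe1 \<theta> x * coframe1 \<theta> u * v$2)
     - (inverse (\<theta>$2))^3 * (x$2 * u$2 * v$2)"

text \<open>The Levi-Civita Christoffel map of the Fisher metric. The vector in the first summand
  spans the kernel of \<open>coframe1 \<theta>\<close>.\<close>

definition fisher_connection :: "real^2 \<Rightarrow> real^2 \<Rightarrow> real^2 \<Rightarrow> real^2" where
  "fisher_connection \<theta> u v =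
     (coframe1 \<theta> u * coframe1 \<theta> v / 2) *\<^sub>R ((\<theta>$1 / \<theta>$2) *\<^sub>R axis 1 1 + axis 2 1)
     - inverse (\<theta>$2) *\<^sub>R (((u$1 * v$2 + u$2 * v$1) / 2) *\<^sub>R axis 1 1 + (u$2 * v$2) *\<^sub>R axis 2 1)"

text \<open>Product rule: the summands differentiate in turn the coframe coefficients, the slope
  \<open>\<theta>$1 / \<theta>$2\<close> in the frame vector, and the factor
  \<open>inverse (\<theta>$2)\<close>.\<close>

definition fisher_connection_deriv :: "real^2 \<Rightarrow> real^2 \<Rightarrow> real^2 \<Rightarrow> real^2 \<Rightarrow> real^2" where
  "fisher_connection_deriv \<theta> x u v =
     (- inverse (\<theta>$2) * coframe1 \<theta> x * (u$2 * coframe1 \<theta> v + coframe1 \<theta> u * v$2) / 2)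
       *\<^sub>R ((\<theta>$1 / \<theta>$2) *\<^sub>R axis 1 1 + axis 2 1)
     + (coframe1 \<theta> u * coframe1 \<theta> v / 2 * inverse (\<theta>$2) * coframe1 \<theta> x) *\<^sub>R axis 1 1
     + ((inverse (\<theta>$2))\<^sup>2 * x$2)
       *\<^sub>R (((u$1 * v$2 + u$2 * v$1) / 2) *\<^sub>R axis 1 1 + (u$2 * v$2) *\<^sub>R axis 2 1)"

lemma axis_component: "axis i x $ j = (if j = i then x else 0)"
  by (simp add: axis_def)

lemma fisher_form_eq:
  assumes "\<theta> \<in> gaussian_domain"
  shows "u \<bullet> (fisher_matrix \<theta> *v v) = fisher_form \<theta> u v"
proof -
  have "\<theta>$2 < 0" using assms by (simp add: gaussian_domain_def)
  then show ?thesis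
    by (simp add: fisher_form_def fisher_matrix_def coframe1_def inner_vec_def sum_2
        matrix_vector_mult_def field_simps power2_eq_square)
qed

section \<open>Derivatives with respect to the base point\<close>

lemma has_derivative_coframe1:
  assumes "\<theta>$2 \<noteq> 0"
  shows "((\<lambda>\<theta>. coframe1 \<theta> u) has_derivative
    (\<lambda>x. - inverse (\<theta>$2) * coframe1 \<theta> x * u$2)) (at \<theta>)"
  unfolding coframe1_def using assms
  by (auto intro!: derivative_eq_intros has_derivative_nth
      simp: fun_eq_iff field_simps power2_eq_square)

lemma has_derivative_inverse_nth:
  assumes "\<theta>$2 \<noteq> (0::real)"
  shows "((\<lambda>\<theta>::real^2. inverse (\<theta>$2)) has_derivative (\<lambda>x. - (inverse (\<theta>$2))\<^sup>2 * x$2)) (at \<theta>)"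
  using assms
  by (auto intro!: derivative_eq_intros has_derivative_nth
      simp: fun_eq_iff field_simps power2_eq_square)

text \<open>\<open>coframe1\<close> is \<open>\<theta>$2\<close> times the differential of the
  slope. This closes the family of slope, reciprocal and coframe under differentiation.\<close>

lemma has_derivative_slope:
  assumes "\<theta>$2 \<noteq> 0"
  shows "((\<lambda>\<theta>::real^2. \<theta>$1 / \<theta>$2) has_derivative (\<lambda>x. inverse (\<theta>$2) * coframe1 \<theta> x)) (at \<theta>)"
  unfolding coframe1_def using assms
  by (auto intro!: derivative_eq_intros has_derivative_nth
      simp: fun_eq_iff field_simps power2_eq_square)

lemma has_derivative_fisher_form:
  assumes "\<theta>$2 \<noteq> 0"
  shows "((\<lambda>\<theta>. fisher_form \<theta> u v) has_derivative (\<lambda>x. fisher_form_deriv \<theta> x u v)) (at \<theta>)"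
  unfolding fisher_form_def fisher_form_deriv_def
  by (rule has_derivative_coframe1 has_derivative_inverse_nth assms numeral_neq_zero
        derivative_eq_intros refl)+
     (simp add: fun_eq_iff algebra_simps power2_eq_square power3_eq_cube)

lemma has_derivative_fisher_connection:
  assumes "\<theta>$2 \<noteq> 0"
  shows "((\<lambda>\<theta>. fisher_connection \<theta> u v) has_derivative
    (\<lambda>x. fisher_connection_deriv \<theta> x u v)) (at \<theta>)"
  unfolding fisher_connection_def fisher_connection_deriv_def
  by (rule has_derivative_coframe1 has_derivative_inverse_nth has_derivative_slope assms
        numeral_neq_zero derivative_eq_intros refl)+
     (simp add: fun_eq_iff vec_eq_iff forall_2 axis_component algebra_simps add_divide_distrib
      diff_divide_distrib power2_eq_square)

text \<open>Total symmetry of the cubic form collapses the three terms of Koszul's formula into one,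
  so the connection is half the cubic form with an index raised.\<close>

lemma fisher_form_connection:
  assumes "\<theta>$2 \<noteq> 0"
  shows "fisher_form \<theta> (fisher_connection \<theta> u v) z = fisher_form_deriv \<theta> u v z / 2"
proof -
  \<comment> \<open>The identity is polynomial in slope and reciprocal even when these are treated
    as independent, so both are made opaque.\<close>
  define s where "s = \<theta>$1 / \<theta>$2"
  define r where "r = inverse (\<theta>$2)"
  show ?thesis
    unfolding fisher_form_def fisher_connection_def fisher_form_deriv_def coframe1_def
      s_def[symmetric] r_def[symmetric]
    by (simp add: axis_component field_simps power2_eq_square power3_eq_cube)
qed

lemma fisher_form_deriv_commute:
  "fisher_form_deriv \<theta> x u v = fisher_form_deriv \<theta> u x v"
  "fisher_form_deriv \<theta> x u v = fisher_form_deriv \<theta> x v u"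
  by (simp_all add: fisher_form_deriv_def algebra_simps)

lemma fisher_form_add_diff:
  "fisher_form \<theta> (u + u') v = fisher_form \<theta> u v + fisher_form \<theta> u' v"
  "fisher_form \<theta> (u - u') v = fisher_form \<theta> u v - fisher_form \<theta> u' v"
  by (simp_all add: fisher_form_def coframe1_def algebra_simps diff_divide_distrib add_divide_distrib)

lemma fisher_form_pos:
  assumes "\<theta>$2 < 0" "u \<noteq> 0"
  shows "fisher_form \<theta> u u > 0"
proof -
  have r: "- inverse (\<theta>$2) / 2 > 0" "(inverse (\<theta>$2))\<^sup>2 / 2 > 0" using assms by simp_all
  have eq: "fisher_form \<theta> u u =
      - inverse (\<theta>$2) / 2 * (coframe1 \<theta> u)\<^sup>2 + (inverse (\<theta>$2))\<^sup>2 / 2 * (u$2)\<^sup>2"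
    unfolding fisher_form_def power2_eq_square by simp
  \<comment> \<open>The two covectors form a basis, so one of them detects \<open>u\<close>.\<close>
  have "coframe1 \<theta> u \<noteq> 0 \<or> u$2 \<noteq> 0"
    using assms by (auto simp: coframe1_def vec_eq_iff forall_2)
  then consider "coframe1 \<theta> u \<noteq> 0" | "u$2 \<noteq> 0" by blast
  then show ?thesis
  proof cases
    case 1
    then show ?thesis
      unfolding eq using r by (intro add_pos_nonneg mult_pos_pos mult_nonneg_nonneg) simp_all
  next
    case 2
    then show ?thesis
      unfolding eq using r by (intro add_nonneg_pos mult_pos_pos mult_nonneg_nonneg) simp_all
  qed
qed

section \<open>Duality and traces\<close>

lemma sharp_eqI:
  assumes "\<And>z. g p w z = \<alpha> z"
    and "\<And>w'. (\<And>z. g p w' z = g p w z) \<Longrightarrow> w' = w"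
  shows "sharp g p \<alpha> = w"
  unfolding sharp_def by (rule the_equality) (use assms in auto)

lemma trace_endo_pair_vec2:
  fixes L :: "(real^2) \<times> (real^2) \<Rightarrow> (real^2) \<times> (real^2)"
  shows "trace_endo L = fst (L (axis 1 1, 0)) $ 1 + fst (L (axis 2 1, 0)) $ 2
    + snd (L (0, axis 1 1)) $ 1 + snd (L (0, axis 2 1)) $ 2"
proof -
  have B: "(Basis :: (real^2) set) = {axis 1 1, axis 2 1}"
    by (auto simp: Basis_vec_def UNIV_2)
  have n: "axis 1 1 \<noteq> (axis 2 1 :: real^2)" by (simp add: axis_eq_axis)
  have B2: "(Basis :: ((real^2) \<times> (real^2)) set) =
      {(axis 1 1, 0), (axis 2 1, 0), (0, axis 1 1), (0, axis 2 1)}"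
    unfolding Basis_prod_def B by auto
  show ?thesis
    unfolding trace_endo_def B2 using n by (simp add: inner_prod_def inner_axis axis_eq_0_iff)
qed

section \<open>The metric and connection of the tangent bundle\<close>

locale gaussian_bundle =
  fixes g :: "((real^2) \<times> (real^2)) metric"
    and J :: "((real^2) \<times> (real^2)) endo_field"
    and \<omega> :: "((real^2) \<times> (real^2)) metric"
  assumes dombrowski: "(g, J, \<omega>) = dombrowski (fisher_metric gaussian) (exponential_connection gaussian)"
begin

lemma nth2_neg: "p \<in> gaussian_TN \<Longrightarrow> fst p $ 2 < 0"
  by (auto simp: gaussian_TN_def gaussian_domain_def)

lemma open_gaussian_TN: "open gaussian_TN"
  unfolding gaussian_TN_def by (intro open_Times open_gaussian_domain open_UNIV)

lemma metric_eq:
  assumes "p \<in> gaussian_TN"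
  shows "g p A B = fisher_form (fst p) (fst A) (fst B) + fisher_form (fst p) (snd A) (snd B)"
proof -
  have "fst p \<in> gaussian_domain" using assms by (auto simp: gaussian_TN_def)
  then show ?thesis
    using dombrowski_gaussian(1)[OF dombrowski, of "fst p" "snd p" "fst A" "snd A" "fst B" "snd B"] assms
    by (simp add: fisher_form_eq)
qed

lemma J_eq: "p \<in> gaussian_TN \<Longrightarrow> J p A = (- snd A, fst A)"
  using dombrowski_gaussian(2)[OF dombrowski, of "fst p" "snd p" "fst A" "snd A"] by simp

text \<open>Supplies the uniqueness behind \<open>sharp\<close>: the difference is paired with
  itself, and both diagonal blocks are positive definite.\<close>

lemma metric_nondegenerate:
  assumes "p \<in> gaussian_TN" "\<And>z. g p w' z = g p w z"
  shows "w' = w"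
proof -
  have "g p (w' - w) (w' - w) = 0"
    using assms(2)[of "w' - w"] by (simp add: metric_eq[OF assms(1)] fisher_form_add_diff)
  moreover have "fisher_form (fst p) x x \<ge> 0" "fisher_form (fst p) x x = 0 \<Longrightarrow> x = 0" for x
    using fisher_form_pos[OF nth2_neg[OF assms(1)], of x]
    by (cases "x = 0"; force simp: fisher_form_def coframe1_def)+
  ultimately have "fst (w' - w) = 0 \<and> snd (w' - w) = 0"
    unfolding metric_eq[OF assms(1)] by (metis add_nonneg_eq_0_iff)
  then show ?thesis by (simp add: prod_eq_iff)
qed

lemma ddir_metric:
  assumes "p \<in> gaussian_TN"
  shows "ddir (\<lambda>q. g q A B) p x =
    fisher_form_deriv (fst p) (fst x) (fst A) (fst B) + fisher_form_deriv (fst p) (fst x) (snd A) (snd B)"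
proof -
  have "fst p $ 2 \<noteq> 0" using nth2_neg[OF assms] by simp
  then show ?thesis
    by (intro ddir_transform[OF open_gaussian_TN assms metric_eq]
        has_derivative_add has_derivative_compose[OF has_derivative_fst[OF has_derivative_ident]]
        has_derivative_fisher_form)
qed

text \<open>With \<open>(a, b)\<close> read as a + ib, this is the complex bilinear extension of
  \<open>fisher_connection\<close>. The metric depends on the base point only, so a derivative along
  \<open>z\<close> sees just \<open>fst z\<close>; symmetry of the cubic form then moves
  \<open>z\<close> to the last slot.\<close>

lemma levi_civita_eq:
  assumes "p \<in> gaussian_TN"
  shows "levi_civita g p A B =
    (fisher_connection (fst p) (fst A) (fst B) - fisher_connection (fst p) (snd A) (snd B),
     fisher_connection (fst p) (fst A) (snd B) + fisher_connection (fst p) (snd A) (fst B))"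
  unfolding levi_civita_def
proof (rule sharp_eqI)
  have [simp]: "fst p $ 2 \<noteq> 0" using nth2_neg[OF assms] by simp
  let ?T = "fisher_form_deriv (fst p)"
  show "g p (fisher_connection (fst p) (fst A) (fst B) - fisher_connection (fst p) (snd A) (snd B),
     fisher_connection (fst p) (fst A) (snd B) + fisher_connection (fst p) (snd A) (fst B)) z =
    (ddir (\<lambda>q. g q B z) p A + ddir (\<lambda>q. g q A z) p B - ddir (\<lambda>q. g q A B) p z) / 2" for z
    \<comment> \<open>As permutative rewrite rules these sort the arguments, so that matching Koszul
      terms cancel.\<close>
    using fisher_form_deriv_commute[of "fst p"]
    unfolding metric_eq[OF assms] ddir_metric[OF assms]
    by (simp add: fisher_form_add_diff fisher_form_connection)
qed (rule metric_nondegenerate[OF assms])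

lemma ddir_levi_civita:
  assumes "p \<in> gaussian_TN"
  shows "ddir (\<lambda>q. levi_civita g q A B) p x =
    (fisher_connection_deriv (fst p) (fst x) (fst A) (fst B)
       - fisher_connection_deriv (fst p) (fst x) (snd A) (snd B),
     fisher_connection_deriv (fst p) (fst x) (fst A) (snd B)
       + fisher_connection_deriv (fst p) (fst x) (snd A) (fst B))"
proof -
  have "fst p $ 2 \<noteq> 0" using nth2_neg[OF assms] by simp
  then show ?thesis
    by (intro ddir_transform[OF open_gaussian_TN assms levi_civita_eq]
        has_derivative_Pair has_derivative_add has_derivative_diff
        has_derivative_compose[OF has_derivative_fst[OF has_derivative_ident]]
        has_derivative_fisher_connection)
qed

section \<open>Curvature\<close>

lemma curvature_eq:
  assumes "p \<in> gaussian_TN"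
  shows "curvature g p x y z =
    ddir (\<lambda>q. levi_civita g q y z) p x + levi_civita g p x (levi_civita g p y z)
    - (ddir (\<lambda>q. levi_civita g q x z) p y + levi_civita g p y (levi_civita g p x z))"
proof -
  \<comment> \<open>Constant fields commute; this removes the bracket term.\<close>
  have "levi_civita g p 0 z = 0"
    by (simp add: levi_civita_eq[OF assms] fisher_connection_def coframe1_def zero_prod_def)
  moreover have "covariant_deriv (levi_civita g) (\<lambda>_. u) (\<lambda>_. z) = (\<lambda>q. levi_civita g q u z)" for u
    by (simp add: fun_eq_iff covariant_deriv_def ddir_def)
  ultimately show ?thesis
    by (simp add: curvature_def curvature_field_def covariant_deriv_def lie_bracket_def ddir_def)
qed

text \<open>The direct computation agrees with the Kaehler formula: on each block Ric is -1/2 times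
  the Hessian of log det h. Since det h is \<open>- 1 / (4 * \<theta>$2 ^ 3)\<close>, only the
  second components survive, with factor 3/2.\<close>

lemma ricci_eq:
  assumes "p \<in> gaussian_TN"
  shows "ricci g p x y =
    - 3 / 2 * (inverse (fst p $ 2))\<^sup>2 * (fst x $ 2 * fst y $ 2 + snd x $ 2 * snd y $ 2)"
proof -
  define s where "s = fst p $ 1 / fst p $ 2"
  define r where "r = inverse (fst p $ 2)"
  show ?thesis
    unfolding ricci_def trace_endo_pair_vec2 curvature_eq[OF assms] ddir_levi_civita[OF assms]
      levi_civita_eq[OF assms]
    unfolding fisher_connection_def fisher_connection_deriv_def coframe1_def
      s_def[symmetric] r_def[symmetric]
    by (simp add: axis_component) (simp add: field_simps power2_eq_square)
qed

lemma scalar_curvature_eq: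
  assumes "p \<in> gaussian_TN"
  shows "scalar_curvature g p = - 6"
proof -
  have [simp]: "fst p $ 2 \<noteq> 0" using nth2_neg[OF assms] by simp
  \<comment> \<open>As \<open>coframe1\<close> kills \<open>v\<close>, lowering its index leaves
    only the second coordinate, scaled by \<open>(inverse (fst p $ 2))\<^sup>2 / 2\<close>.\<close>
  define v where "v = (fst p $ 1 / fst p $ 2) *\<^sub>R axis 1 1 + (axis 2 1 :: real^2)"
  have v: "v $ 2 = 1" "coframe1 (fst p) (c *\<^sub>R v) = 0" "coframe1 (fst p) (- (c *\<^sub>R v)) = 0" for c
    by (simp_all add: v_def coframe1_def axis_component)
  \<comment> \<open>The factor -3 is the ratio of the Ricci coefficient -3/2 to the metric
    coefficient 1/2. It enters the trace once from each block.\<close>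
  have "sharp g p (ricci g p x) = ((- 3 * fst x $ 2) *\<^sub>R v, (- 3 * snd x $ 2) *\<^sub>R v)" for x
    by (rule sharp_eqI[OF _ metric_nondegenerate[OF assms]])
       (simp add: ricci_eq[OF assms] metric_eq[OF assms] fisher_form_def v algebra_simps)
  then show ?thesis
    by (simp add: scalar_curvature_def trace_endo_pair_vec2 v axis_component)
qed

lemma ricci_nonpos:
  assumes "p \<in> gaussian_TN"
  shows "ricci g p x x \<le> 0"
  by (simp add: ricci_eq[OF assms] mult_nonneg_nonneg)

section \<open>Test directions at one point\<close>

abbreviation base_point :: "(real^2) \<times> (real^2)" where
  "base_point \<equiv> (- axis 2 1, 0)"

lemma base_point: "base_point \<in> gaussian_TN"
  by (simp add: gaussian_TN_def gaussian_domain_def)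

text \<open>At this point the first axis is in the kernel of Ric, forcing \<open>c = 0\<close>,
  whereas the second gives \<open>c = - 3\<close>.\<close>

lemma not_einstein: "\<not> einstein gaussian_TN g"
proof
  assume "einstein gaussian_TN g"
  then obtain c where c: "\<And>x y. ricci g base_point x y = c * g base_point x y"
    using base_point unfolding einstein_def by metis
  show False
    using c[of "(axis 1 1, 0)" "(axis 1 1, 0)"] c[of "(axis 2 1, 0)" "(axis 2 1, 0)"]
    by (simp add: ricci_eq[OF base_point] metric_eq[OF base_point] fisher_form_def coframe1_def axis_component)
qed

text \<open>Here the metric is half the Euclidean one. The value -2 is the curvature of the
  half-plane where both first coordinates vanish, with metric
  \<open>1 / (2 * (\<theta>$2)\<^sup>2)\<close> times the flat one; it is totally geodesic as the
  fixed set of a sign change.\<close>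

lemma holomorphic_sectional_curvature_base_point:
  "holomorphic_sectional_curvature g J base_point (axis 1 1, 0) = 1"
  "holomorphic_sectional_curvature g J base_point (axis 2 1, 0) = - 2"
  unfolding holomorphic_sectional_curvature_def curvature_eq[OF base_point] J_eq[OF base_point]
    ddir_levi_civita[OF base_point] levi_civita_eq[OF base_point] metric_eq[OF base_point]
    fisher_form_def fisher_connection_def fisher_connection_deriv_def coframe1_def
  by (simp_all add: axis_component power2_eq_square)

lemma holomorphic_sectional_curvature_not_constant:
  "\<not> (\<exists>c. \<forall>p\<in>gaussian_TN. \<forall>u. u \<noteq> 0 \<longrightarrow> holomorphic_sectional_curvature g J p u = c)"
proof
  assume "\<exists>c. \<forall>p\<in>gaussian_TN. \<forall>u. u \<noteq> 0 \<longrightarrow> holomorphic_sectional_curvature g J p u = c"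
  then obtain c where "\<And>u. u \<noteq> 0 \<Longrightarrow> holomorphic_sectional_curvature g J base_point u = c"
    using base_point by blast
  from this[of "(axis 1 1, 0)"] this[of "(axis 2 1, 0)"] show False
    by (simp add: holomorphic_sectional_curvature_base_point axis_eq_0_iff zero_prod_def)
qed

end

theorem corollary3p9:
  fixes g :: "((real^2) \<times> (real^2)) metric"
    and J :: "((real^2) \<times> (real^2)) endo_field"
    and \<omega> :: "((real^2) \<times> (real^2)) metric"
  assumes "(g, J, \<omega>) = dombrowski (fisher_metric gaussian) (exponential_connection gaussian)"
  shows "(\<forall>p\<in>gaussian_TN. \<forall>X. ricci g p X X \<le> 0) \<and>
         (\<not> einstein gaussian_TN g \<and>
          \<not> (\<exists>c. \<forall>p\<in>gaussian_TN. \<forall>u. u \<noteq> 0 \<longrightarrow> holomorphic_sectional_curvature g J p u = c)) \<and>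
         (\<forall>p\<in>gaussian_TN. scalar_curvature g p = - 6)"
proof -
  interpret gaussian_bundle g J \<omega> by unfold_locales (rule assms)
  show ?thesis
    using ricci_nonpos not_einstein holomorphic_sectional_curvature_not_constant
      scalar_curvature_eq by blast
qed

end
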